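(* Let $1\leq p\leq\infty$, let $\mathcal{M}$ be a $\mathrm{C}^{p+1}$-manifold of dimension $n\geq1$, let $\mathcal{V}$ be a complete $\mathrm{C}^p$-vector field on $\mathcal{M}$, let $\mathcal{B}$ be a complex Banach space, let $\lambda\in\mathbb{C}$ with $\mathrm{Re}\,\lambda\neq0$, and let $f\in\mathrm{C}^0(\mathcal{M};\mathcal{B})$. Then the equation $\mathcal{V}y=\lambda y+f$ has $\mathrm{C}^1_{\mathcal{V}}$-Hyers–Ulam stability with stability constant $|\mathrm{Re}\,\lambda|^{-1}$; that is, for every $\epsilon\geq0$ and every $y\in\mathrm{C}^1_{\mathcal{V}}(\mathcal{M};\mathcal{B})$ satisfying $\|\mathcal{V}y-\lambda y-f\|_\infty\leq\epsilon$, there exists $z\in\mathrm{C}^1_{\mathcal{V}}(\mathcal{M};\mathcal{B})$ such that $\mathcal{V}z=\lambda z+f$ and $\|y-z\|_\infty\leq|\mathrm{Re}\,\lambda|^{-1}\epsilon$.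
   Context: $\mathrm{C}^k(\mathcal{M};\mathcal{B})$ denotes the space of $\mathrm{C}^k$ maps $\mathcal{M}\to\mathcal{B}$, and $\|g\|_\infty=\sup_{x\in\mathcal{M}}\|g(x)\|$. For a map $y:\mathcal{M}\to\mathcal{B}$ that is differentiable along every integral curve of $\mathcal{V}$, $\mathcal{V}y:\mathcal{M}\to\mathcal{B}$ is defined by $\mathcal{V}y(x)=(y\circ\gamma_x)'(0)$, where $\gamma_x$ is an integral curve of $\mathcal{V}$ with $\gamma_x(0)=x$. $\mathrm{C}^1_{\mathcal{V}}(\mathcal{M};\mathcal{B})$ denotes the set of maps $y:\mathcal{M}\to\mathcal{B}$ that are continuous, differentiable along every integral curve of $\mathcal{V}$, and such that $\mathcal{V}y$ is continuous. A vector field is complete if its flow is defined on all of $\mathbb{R}\times\mathcal{M}$. *)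

theory Defs
  imports "HOL-Analysis.Analysis" "HOL-Library.Extended_Nat"
begin

class complex_banach = banach +
  fixes scaleC :: "complex \<Rightarrow> 'a \<Rightarrow> 'a"  (infixr \<open>*\<^sub>C\<close> 75)
  assumes scaleC_add_right: "scaleC a (x + y) = scaleC a x + scaleC a y"
    and scaleC_add_left: "scaleC (a + b) x = scaleC a x + scaleC b x"
    and scaleC_scaleC: "scaleC a (scaleC b x) = scaleC (a * b) x"
    and scaleC_one: "scaleC 1 x = x"
    and scaleC_of_real: "scaleC (of_real r) x = r *\<^sub>R x"
    and norm_scaleC: "norm (scaleC a x) = cmod a * norm x"

text \<open>\<open>Ck_nat k S f\<close>: on the open set S, f has all iterated partial derivatives
  (along the standard basis) of order at most k, and they are all continuous.
  \<open>D ds\<close> is the iterated partial derivative along the directions in the list ds.\<close>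

definition Ck_nat :: "nat \<Rightarrow> 'a::euclidean_space set \<Rightarrow> ('a \<Rightarrow> 'b::real_normed_vector) \<Rightarrow> bool" where
  "Ck_nat k S f \<longleftrightarrow>
     (\<exists>D :: 'a list \<Rightarrow> 'a \<Rightarrow> 'b.
        D [] = f \<and>
        (\<forall>ds. length ds < k \<longrightarrow> set ds \<subseteq> Basis \<longrightarrow> (\<forall>x\<in>S. \<forall>v\<in>Basis.
            ((\<lambda>t. D ds (x + t *\<^sub>R v)) has_vector_derivative D (v # ds) x) (at 0))) \<and>
        (\<forall>ds. length ds \<le> k \<longrightarrow> set ds \<subseteq> Basis \<longrightarrow> continuous_on S (D ds)))"

definition Ck_on :: "enat \<Rightarrow> 'a::euclidean_space set \<Rightarrow> ('a \<Rightarrow> 'b::real_normed_vector) \<Rightarrow> bool" where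
  "Ck_on k S f \<longleftrightarrow> (\<forall>m::nat. enat m \<le> k \<longrightarrow> Ck_nat m S f)"

text \<open>A chart is a pair (U, \<phi>) with U open in the manifold and \<phi> a homeomorphism of U
  onto an open subset of the model Euclidean space 'e (of dimension n = DIM('e)).\<close>

definition is_chart :: "'m::topological_space set \<times> ('m \<Rightarrow> 'e::euclidean_space) \<Rightarrow> bool" where
  "is_chart c \<longleftrightarrow> open (fst c) \<and> open (snd c ` fst c) \<and>
     (\<exists>\<psi>. homeomorphism (fst c) (snd c ` fst c) (snd c) \<psi>)"

definition transition :: "'m set \<times> ('m \<Rightarrow> 'e) \<Rightarrow> 'm set \<times> ('m \<Rightarrow> 'e) \<Rightarrow> 'e \<Rightarrow> 'e" where
  "transition c1 c2 = snd c2 \<circ> inv_into (fst c1) (snd c1)"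

text \<open>A C^k atlas: charts covering the whole space with C^k transition maps.
  The manifold is the whole (Hausdorff, second countable) type 'm.\<close>

definition Ck_atlas :: "enat \<Rightarrow> ('m::topological_space set \<times> ('m \<Rightarrow> 'e::euclidean_space)) set \<Rightarrow> bool" where
  "Ck_atlas k A \<longleftrightarrow>
     (\<Union>c\<in>A. fst c) = UNIV \<and> (\<forall>c\<in>A. is_chart c) \<and>
     (\<forall>c1\<in>A. \<forall>c2\<in>A. Ck_on k (snd c1 ` (fst c1 \<inter> fst c2)) (transition c1 c2))"

text \<open>A vector field is given by its local representatives \<open>V c : 'e \<Rightarrow> 'e\<close> in each chart c,
  which must be C^p on the chart image and transform by the Jacobian of the
  transition maps.\<close>

definition Ck_vector_field ::
  "enat \<Rightarrow> ('m::topological_space set \<times> ('m \<Rightarrow> 'e::euclidean_space)) set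
     \<Rightarrow> ('m set \<times> ('m \<Rightarrow> 'e) \<Rightarrow> 'e \<Rightarrow> 'e) \<Rightarrow> bool" where
  "Ck_vector_field k A V \<longleftrightarrow>
     (\<forall>c\<in>A. Ck_on k (snd c ` fst c) (V c)) \<and>
     (\<forall>c1\<in>A. \<forall>c2\<in>A. \<forall>x\<in>fst c1 \<inter> fst c2.
        V c2 (snd c2 x) = frechet_derivative (transition c1 c2) (at (snd c1 x)) (V c1 (snd c1 x)))"

definition integral_curve ::
  "('m::topological_space set \<times> ('m \<Rightarrow> 'e::euclidean_space)) set
     \<Rightarrow> ('m set \<times> ('m \<Rightarrow> 'e) \<Rightarrow> 'e \<Rightarrow> 'e) \<Rightarrow> real set \<Rightarrow> (real \<Rightarrow> 'm) \<Rightarrow> bool" where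
  "integral_curve A V J \<gamma> \<longleftrightarrow>
     open J \<and> is_interval J \<and> continuous_on J \<gamma> \<and>
     (\<forall>t\<in>J. \<forall>c\<in>A. \<gamma> t \<in> fst c \<longrightarrow>
        ((snd c \<circ> \<gamma>) has_vector_derivative V c (snd c (\<gamma> t))) (at t))"

definition complete_vf ::
  "('m::topological_space set \<times> ('m \<Rightarrow> 'e::euclidean_space)) set
     \<Rightarrow> ('m set \<times> ('m \<Rightarrow> 'e) \<Rightarrow> 'e \<Rightarrow> 'e) \<Rightarrow> bool" where
  "complete_vf A V \<longleftrightarrow> (\<forall>x. \<exists>\<gamma>. integral_curve A V UNIV \<gamma> \<and> \<gamma> 0 = x)"

definition diff_along ::
  "('m::topological_space set \<times> ('m \<Rightarrow> 'e::euclidean_space)) set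
     \<Rightarrow> ('m set \<times> ('m \<Rightarrow> 'e) \<Rightarrow> 'e \<Rightarrow> 'e) \<Rightarrow> ('m \<Rightarrow> 'b::real_normed_vector) \<Rightarrow> bool" where
  "diff_along A V y \<longleftrightarrow>
     (\<forall>J \<gamma>. integral_curve A V J \<gamma> \<longrightarrow> (\<forall>t\<in>J. (y \<circ> \<gamma>) differentiable (at t)))"

text \<open>(V y)(x) = (y \<circ> \<gamma>_x)'(0), \<gamma>_x an integral curve with \<gamma>_x(0) = x (for complete V,
  taken defined on all of \<real>).\<close>
definition Vderiv ::
  "('m::topological_space set \<times> ('m \<Rightarrow> 'e::euclidean_space)) set
     \<Rightarrow> ('m set \<times> ('m \<Rightarrow> 'e) \<Rightarrow> 'e \<Rightarrow> 'e) \<Rightarrow> ('m \<Rightarrow> 'b::real_normed_vector) \<Rightarrow> 'm \<Rightarrow> 'b" where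
  "Vderiv A V y x =
     vector_derivative (y \<circ> (SOME \<gamma>. integral_curve A V UNIV \<gamma> \<and> \<gamma> 0 = x)) (at 0)"

definition C1V ::
  "('m::topological_space set \<times> ('m \<Rightarrow> 'e::euclidean_space)) set
     \<Rightarrow> ('m set \<times> ('m \<Rightarrow> 'e) \<Rightarrow> 'e \<Rightarrow> 'e) \<Rightarrow> ('m \<Rightarrow> 'b::real_normed_vector) \<Rightarrow> bool" where
  "C1V A V y \<longleftrightarrow> continuous_on UNIV y \<and> diff_along A V y \<and> continuous_on UNIV (Vderiv A V y)"

end

theory Submission
  imports Defs
begin

text \<open>For \<open>Re lam > 0\<close> put \<open>g = Vy - lam y - f\<close> and
  \<open>z x = y x + \<integral>\<^sub>0\<^sup>\<infinity> exp (- lam s) g (flow s x) ds\<close>. The integral is bounded by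
  \<open>\<epsilon> / Re lam\<close>, depends continuously on \<open>x\<close>, and its derivative along the flow is
  \<open>lam\<close> times itself minus \<open>g\<close>, so \<open>z\<close> solves the equation exactly. For \<open>Re lam < 0\<close>
  reverse time. Uniqueness of integral curves and continuity of the flow follow from the local
  Lipschitz property of the field in charts.\<close>

text \<open>The integral is forced. For \<open>z = y + w\<close> to solve the equation,
  \<open>w\<close> must satisfy \<open>Vw = lam w - g\<close>; along an orbit this says that
  \<open>exp (- lam t) w (flow t x)\<close> equals \<open>w x\<close> minus the integral of
  \<open>exp (- lam s) g (flow s x)\<close> over \<open>0 \<le> s \<le> t\<close>. If
  \<open>w\<close> is bounded and \<open>Re lam > 0\<close>, the first quantity tends to 0 as
  \<open>t\<close> grows, so the full integral is the only candidate for \<open>w x\<close>. The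
  stability constant is the integral of \<open>exp (- Re lam s)\<close> over the half line. As
  \<open>g\<close> is merely continuous, \<open>z\<close> cannot be expected to be differentiable
  across orbits; what has to be checked is continuity on the manifold and a derivative along the
  flow. Continuity requires every time-\<open>t\<close> map of the flow to be continuous on the
  whole manifold, although charts and Lipschitz constants are only local. This is the main obstacle:
  an estimate inside one chart works for short times only, and the group law must carry it to all
  times.\<close>

lemma bounded_bilinear_scaleC:
  "bounded_bilinear (scaleC :: complex \<Rightarrow> 'b::complex_banach \<Rightarrow> 'b)"
proof (unfold_locales)
  fix r :: real and a b :: complex and x y :: 'b
  show "(a + b) *\<^sub>C x = a *\<^sub>C x + b *\<^sub>C x" by (rule scaleC_add_left)
  show "a *\<^sub>C (x + y) = a *\<^sub>C x + a *\<^sub>C y" by (rule scaleC_add_right)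
  show "(r *\<^sub>R a) *\<^sub>C x = r *\<^sub>R a *\<^sub>C x"
    by (metis scaleC_of_real scaleC_scaleC scaleR_conv_of_real)
  show "a *\<^sub>C r *\<^sub>R x = r *\<^sub>R a *\<^sub>C x"
    by (metis scaleC_of_real scaleC_scaleC mult.commute)
  show "\<exists>K. \<forall>(a::complex) (x::'b). norm (a *\<^sub>C x) \<le> norm a * norm x * K"
    by (rule exI[of _ 1]) (simp add: norm_scaleC)
qed

interpretation scaleC: bounded_bilinear
  "scaleC :: complex \<Rightarrow> 'b::complex_banach \<Rightarrow> 'b"
  by (rule bounded_bilinear_scaleC)

section \<open>The Laplace transform of a bounded continuous function\<close>

definition laplace_upto :: "complex \<Rightarrow> (real \<Rightarrow> 'b::complex_banach) \<Rightarrow> real \<Rightarrow> 'b" where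
  "laplace_upto lam h T = integral {0..T} (\<lambda>s. exp (- lam * of_real s) *\<^sub>C h s)"

text \<open>The improper integral is a limit of integrals over compact intervals, so that estimates
  and substitutions take place on such intervals. \<open>Lim\<close> denotes a genuine limit only
  where \<open>tendsto_laplace\<close> applies.\<close>

definition laplace :: "complex \<Rightarrow> (real \<Rightarrow> 'b::complex_banach) \<Rightarrow> 'b" where
  "laplace lam h = Lim at_top (laplace_upto lam h)"

lemma continuous_on_laplace_integrand:
  fixes h :: "real \<Rightarrow> 'b::complex_banach"
  assumes "continuous_on X h"
  shows "continuous_on X (\<lambda>s. exp (- lam * of_real s) *\<^sub>C h s)"
  by (intro scaleC.continuous_on continuous_intros assms)

lemma norm_laplace_integrand:
  "norm (exp (- lam * of_real s) *\<^sub>C (v::'b::complex_banach)) = exp (- Re lam * s) * norm v"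
  by (simp add: norm_scaleC norm_exp_eq_Re)

text \<open>The integrand is dominated by \<open>e * exp (- Re lam * s)\<close>, and the bound is
  the integral of this majorant from \<open>S\<close> to infinity. Being independent of
  \<open>T\<close> and of \<open>h\<close>, it later gives convergence as well as uniformity in a
  parameter.\<close>

lemma laplace_upto_diff_bound:
  fixes h :: "real \<Rightarrow> 'b::complex_banach"
  assumes a: "0 < Re lam" and h: "continuous_on UNIV h" and bd: "\<And>s. norm (h s) \<le> e"
    and ST: "0 \<le> S" "S \<le> T"
  shows "norm (laplace_upto lam h T - laplace_upto lam h S) \<le> e * exp (- Re lam * S) / Re lam"
proof -
  let ?u = "\<lambda>s. exp (- lam * of_real s) *\<^sub>C h s"
  let ?a = "Re lam"
  have cont: "continuous_on X ?u" for X
    by (rule continuous_on_laplace_integrand) (rule continuous_on_subset[OF h], simp)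
  have e0: "0 \<le> e" using bd[of 0] norm_ge_zero order_trans by blast
  have "integral {0..S} ?u + integral {S..T} ?u = integral {0..T} ?u"
    by (rule Henstock_Kurzweil_Integration.integral_combine)
       (use ST cont in \<open>auto intro: integrable_continuous_real\<close>)
  then have eq: "laplace_upto lam h T - laplace_upto lam h S = integral {S..T} ?u"
    unfolding laplace_upto_def by (simp add: algebra_simps)
  have hi: "((\<lambda>s. e * exp (- ?a * s)) has_integral
      (- e * exp (- ?a * T) / ?a) - (- e * exp (- ?a * S) / ?a)) {S..T}"
    by (rule fundamental_theorem_of_calculus)
       (use ST a in \<open>auto intro!: derivative_eq_intros simp flip: has_real_derivative_iff_has_vector_derivative\<close>)
  have "norm (integral {S..T} ?u) \<le> integral {S..T} (\<lambda>s. e * exp (- ?a * s))"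
  proof (rule integral_norm_bound_integral)
    show "?u integrable_on {S..T}" by (intro integrable_continuous_real cont)
    show "(\<lambda>s. e * exp (- ?a * s)) integrable_on {S..T}" using hi by blast
    show "norm (?u s) \<le> e * exp (- ?a * s)" for s
      using mult_right_mono[OF bd[of s], of "exp (- ?a * s)"]
      unfolding norm_laplace_integrand by (simp add: mult.commute)
  qed
  also have "\<dots> = (- e * exp (- ?a * T) / ?a) - (- e * exp (- ?a * S) / ?a)"
    using hi by (rule integral_unique)
  also have "\<dots> \<le> e * exp (- ?a * S) / ?a"
    using e0 a by simp
  finally show ?thesis unfolding eq .
qed

lemma tendsto_laplace_tail:
  fixes lam :: complex
  assumes "0 < Re lam"
  shows "((\<lambda>S. e * exp (- Re lam * S) / Re lam) \<longlongrightarrow> (0::real)) at_top"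
proof -
  have "((\<lambda>S. exp (- Re lam * S)) \<longlongrightarrow> 0) at_top"
    by (rule filterlim_compose[OF exp_at_bot])
       (rule filterlim_tendsto_neg_mult_at_bot[OF tendsto_const _ filterlim_ident], use assms in simp)
  from tendsto_mult_left[OF this, of "e / Re lam"] show ?thesis by (simp add: mult.commute)
qed

text \<open>Completeness of the Banach space enters here. The tail bound makes the values at integer
  times a Cauchy sequence; with the second endpoint running through the integers, it also controls
  the distance from any real time to the limit of that sequence.\<close>

lemma tendsto_laplace:
  fixes h :: "real \<Rightarrow> 'b::complex_banach"
  assumes a: "0 < Re lam" and h: "continuous_on UNIV h" and bd: "\<And>s. norm (h s) \<le> e"
  shows "(laplace_upto lam h \<longlongrightarrow> laplace lam h) at_top"
proof -
  let ?P = "laplace_upto lam h"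
  let ?b = "\<lambda>S. e * exp (- Re lam * S) / Re lam"
  have bound: "norm (?P T - ?P S) \<le> ?b S" if "0 \<le> S" "S \<le> T" for S T
    by (rule laplace_upto_diff_bound[OF a h bd that])
  have b0: "(?b \<longlongrightarrow> 0) at_top" by (rule tendsto_laplace_tail[OF a])
  have "Cauchy (\<lambda>n. ?P (real n))"
  proof (rule CauchyI)
    fix r :: real assume "0 < r"
    then have "\<forall>\<^sub>F S in at_top. ?b S < r / 2 \<and> 0 \<le> S"
      using order_tendstoD(2)[OF b0, of "r/2"] eventually_ge_at_top[of "0::real"]
      by (simp add: eventually_conj)
    then obtain S0 where S0: "\<And>S. S0 \<le> S \<Longrightarrow> ?b S < r / 2 \<and> 0 \<le> S"
      by (auto simp: eventually_at_top_linorder)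
    obtain N where N: "S0 \<le> real N" using real_arch_simple by blast
    have *: "norm (?P (real n) - ?P (real N)) < r / 2" if "N \<le> n" for n
      using bound[of "real N" "real n"] S0[OF N] that by linarith
    show "\<exists>M. \<forall>m\<ge>M. \<forall>n\<ge>M. norm (?P (real m) - ?P (real n)) < r"
    proof (intro exI allI impI)
      fix m n assume "N \<le> m" "N \<le> n"
      from *[OF this(1)] *[OF this(2)] show "norm (?P (real m) - ?P (real n)) < r"
        by (metis dist_norm dist_commute dist_triangle_half_l)
    qed
  qed
  then obtain l where l: "(\<lambda>n. ?P (real n)) \<longlonglongrightarrow> l"
    using Cauchy_convergent convergent_def by blast
  have "norm (?P S - l) \<le> ?b S" if "0 \<le> S" for S
  proof (rule tendsto_upperbound)
    show "((\<lambda>n. norm (?P S - ?P (real n))) \<longlongrightarrow> norm (?P S - l)) sequentially"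
      by (intro tendsto_intros l)
    show "\<forall>\<^sub>F n in sequentially. norm (?P S - ?P (real n)) \<le> ?b S"
      using eventually_ge_at_top[of "nat \<lceil>S\<rceil>"]
    proof eventually_elim
      case (elim n)
      then have "S \<le> real n" by linarith
      from bound[OF that this] show ?case by (simp add: norm_minus_commute)
    qed
  qed simp
  then have "\<forall>\<^sub>F S in at_top. norm (?P S - l) \<le> ?b S"
    by (intro eventually_mono[OF eventually_ge_at_top[of "0::real"]])
  then have "((\<lambda>S. ?P S - l) \<longlongrightarrow> 0) at_top"
    by (rule Lim_null_comparison) (rule b0)
  then have "(?P \<longlongrightarrow> l) at_top" by (simp add: LIM_zero_iff)
  then show ?thesis unfolding laplace_def by (simp add: tendsto_Lim)
qed

lemma laplace_tail_bound:
  fixes h :: "real \<Rightarrow> 'b::complex_banach"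
  assumes a: "0 < Re lam" and h: "continuous_on UNIV h" and bd: "\<And>s. norm (h s) \<le> e"
    and S: "0 \<le> S"
  shows "norm (laplace lam h - laplace_upto lam h S) \<le> e * exp (- Re lam * S) / Re lam"
proof (rule tendsto_upperbound)
  show "((\<lambda>T. norm (laplace_upto lam h T - laplace_upto lam h S)) \<longlongrightarrow>
      norm (laplace lam h - laplace_upto lam h S)) at_top"
    by (intro tendsto_intros tendsto_laplace[OF a h bd])
  show "\<forall>\<^sub>F T in at_top. norm (laplace_upto lam h T - laplace_upto lam h S)
      \<le> e * exp (- Re lam * S) / Re lam"
    using eventually_ge_at_top[of S]
    by eventually_elim (rule laplace_upto_diff_bound[OF a h bd S])
qed simp

text \<open>The tail beyond \<open>S = 0\<close> is the whole transform; this is the source of the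
  stability constant.\<close>

lemma norm_laplace_le:
  fixes h :: "real \<Rightarrow> 'b::complex_banach"
  assumes "0 < Re lam" "continuous_on UNIV h" "\<And>s. norm (h s) \<le> e"
  shows "norm (laplace lam h) \<le> e / Re lam"
  using laplace_tail_bound[OF assms, of 0] by (simp add: laplace_upto_def)

text \<open>Substituting \<open>s \<mapsto> s - t\<close> turns the transform of a translate of \<open>h\<close> into
  \<open>exp (lam t)\<close> times a tail of the transform of \<open>h\<close>; the base point \<open>-1\<close> makes this
  valid on both sides of \<open>t = 0\<close>.\<close>

lemma laplace_shift_has_vector_derivative:
  fixes h :: "real \<Rightarrow> 'b::complex_banach"
  assumes a: "0 < Re lam" and h: "continuous_on UNIV h" and bd: "\<And>s. norm (h s) \<le> e"
  shows "((\<lambda>t. laplace lam (\<lambda>s. h (s + t))) has_vector_derivative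
           lam *\<^sub>C laplace lam h - h 0) (at 0)"
proof -
  let ?u = "\<lambda>s. exp (- lam * of_real s) *\<^sub>C h s"
  let ?P = "\<lambda>t. integral {-1..t} ?u"
  have cont: "continuous_on X ?u" for X
    by (rule continuous_on_laplace_integrand) (rule continuous_on_subset[OF h], simp)
  have int: "?u integrable_on {x..y}" for x y
    by (intro integrable_continuous_real cont)
  have shift: "laplace_upto lam (\<lambda>s. h (s + t)) T = exp (lam * of_real t) *\<^sub>C (?P (T + t) - ?P t)"
    if t: "-1 \<le> t" and T: "0 \<le> T" for t T
  proof -
    have "(?u has_integral integral {t..T+t} ?u) {t..T+t}"
      using int by (rule integrable_integral)
    then have "((\<lambda>s. ?u (s + t)) has_integral integral {t..T+t} ?u) {0..T}"
      using has_integral_affinity[of ?u "integral {t..T+t} ?u" t "T+t" 1 t]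
      by (simp add: image_diff_atLeastAtMost)
    then have "((\<lambda>s. exp (lam * of_real t) *\<^sub>C ?u (s + t)) has_integral
        exp (lam * of_real t) *\<^sub>C integral {t..T+t} ?u) {0..T}"
      by (rule has_integral_linear[OF _ scaleC.bounded_linear_right, unfolded o_def])
    moreover have "exp (lam * of_real t) *\<^sub>C ?u (s + t) = exp (- lam * of_real s) *\<^sub>C h (s + t)" for s
      by (simp add: scaleC_scaleC algebra_simps flip: exp_add)
    ultimately have "laplace_upto lam (\<lambda>s. h (s + t)) T = exp (lam * of_real t) *\<^sub>C integral {t..T+t} ?u"
      unfolding laplace_upto_def by (simp add: integral_unique)
    moreover have "?P t + integral {t..T+t} ?u = ?P (T + t)"
      by (rule Henstock_Kurzweil_Integration.integral_combine) (use t T int in auto)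
    then have "integral {t..T+t} ?u = ?P (T + t) - ?P t" by (simp only: eq_diff_eq add.commute)
    ultimately show ?thesis by (simp only:)
  qed
  \<comment> \<open>\<open>?P 0\<close> is the integral from -1 to 0, so \<open>Pinf\<close> is the
    integral from -1 to infinity and \<open>Pinf - ?P t\<close> is the tail beyond
    \<open>t\<close>.\<close>
  define Pinf where "Pinf = laplace lam h + ?P 0"
  have Plim: "(?P \<longlongrightarrow> Pinf) at_top"
  proof -
    have "((\<lambda>T. laplace_upto lam h T + ?P 0) \<longlongrightarrow> Pinf) at_top"
      unfolding Pinf_def by (intro tendsto_intros tendsto_laplace[OF a h bd])
    then show ?thesis
    proof (rule Lim_transform_eventually)
      show "\<forall>\<^sub>F T in at_top. laplace_upto lam h T + ?P 0 = ?P T"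
        using eventually_ge_at_top[of 0]
        by eventually_elim (use shift[of 0] in \<open>simp add: scaleC_one\<close>)
    qed
  qed
  have formula: "laplace lam (\<lambda>s. h (s + t)) = exp (lam * of_real t) *\<^sub>C (Pinf - ?P t)" if t: "-1 \<le> t" for t
  proof -
    have "(laplace_upto lam (\<lambda>s. h (s + t)) \<longlongrightarrow> laplace lam (\<lambda>s. h (s + t))) at_top"
      by (rule tendsto_laplace[OF a _ bd])
         (intro continuous_intros continuous_on_compose2[OF h], auto)
    moreover have "(laplace_upto lam (\<lambda>s. h (s + t)) \<longlongrightarrow> exp (lam * of_real t) *\<^sub>C (Pinf - ?P t)) at_top"
    proof (rule Lim_transform_eventually)
      have "((\<lambda>T. ?P (T + t)) \<longlongrightarrow> Pinf) at_top"
        by (rule filterlim_compose[OF Plim])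
           (use filterlim_tendsto_add_at_top[OF tendsto_const[of t] filterlim_ident] in \<open>simp add: add.commute\<close>)
      then show "((\<lambda>T. exp (lam * of_real t) *\<^sub>C (?P (T + t) - ?P t)) \<longlongrightarrow>
          exp (lam * of_real t) *\<^sub>C (Pinf - ?P t)) at_top"
        by (intro scaleC.tendsto tendsto_intros)
      show "\<forall>\<^sub>F T in at_top. exp (lam * of_real t) *\<^sub>C (?P (T + t) - ?P t) = laplace_upto lam (\<lambda>s. h (s + t)) T"
        using eventually_ge_at_top[of 0]
        by eventually_elim (use shift[OF t] in simp)
    qed
    ultimately show ?thesis by (rule tendsto_unique[OF trivial_limit_at_top_linorder])
  qed
  have "(?P has_vector_derivative ?u 0) (at 0 within {-1..1})"
    by (rule integral_has_vector_derivative[OF cont]) simp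
  then have P': "(?P has_vector_derivative h 0) (at 0)"
    by (simp add: at_within_Icc_at scaleC_one)
  have "((\<lambda>t. exp (lam * of_real t)) has_vector_derivative lam) (at 0)"
    by (rule has_vector_derivative_real_field) (auto intro!: derivative_eq_intros)
  from scaleC.has_vector_derivative[OF this, of "\<lambda>t. Pinf - ?P t" "- h 0"]
  have "((\<lambda>t. exp (lam * of_real t) *\<^sub>C (Pinf - ?P t)) has_vector_derivative
      lam *\<^sub>C laplace lam h - h 0) (at 0)"
    using has_vector_derivative_diff[OF has_vector_derivative_const P', of Pinf]
    by (simp add: Pinf_def scaleC_one)
  then show ?thesis
    by (rule has_vector_derivative_transform_within_open[where S="{-1<..}"])
       (use formula in auto)
qed

text \<open>For fixed \<open>N\<close> the truncated transform is sequentially continuous by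
  dominated convergence: the weight is at most 1 for \<open>s \<ge> 0\<close>, so
  \<open>2 * e\<close> is a majorant of the difference. The tail bound is uniform in
  \<open>x\<close>, which makes the full transform a uniform limit. Separate continuity of
  \<open>H\<close> suffices for this argument, so continuity of each time map is what will be asked
  of the flow.\<close>

lemma continuous_on_laplace:
  fixes H :: "real \<Rightarrow> 'm::{first_countable_topology, t2_space} \<Rightarrow> 'b::complex_banach"
  assumes a: "0 < Re lam" and Ht: "\<And>x. continuous_on UNIV (\<lambda>s. H s x)"
    and Hx: "\<And>s. continuous_on UNIV (H s)" and bd: "\<And>s x. norm (H s x) \<le> e"
  shows "continuous_on UNIV (\<lambda>x. laplace lam (\<lambda>s. H s x))"
proof (rule uniform_limit_theorem)
  let ?w = "\<lambda>N x. laplace_upto lam (\<lambda>s. H s x) (real N)"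
  let ?u = "\<lambda>x s. exp (- lam * of_real s) *\<^sub>C H s x"
  have cont: "continuous_on X (?u x)" for X x
    by (rule continuous_on_laplace_integrand) (rule continuous_on_subset[OF Ht], simp)
  have int: "?u x integrable_on {p..q}" for x p q
    by (intro integrable_continuous_real cont)
  have "continuous_on UNIV (?w N)" for N
    unfolding continuous_on_sequentially
  proof (intro allI ballI impI, elim conjE, unfold o_def)
    fix X :: "nat \<Rightarrow> 'm" and x assume X: "X \<longlonglongrightarrow> x"
    have cn: "continuous_on {0..real N} (\<lambda>s. norm (?u (X k) s - ?u x s))" for k
      by (intro continuous_intros cont)
    have "(\<lambda>k. integral {0..real N} (\<lambda>s. norm (?u (X k) s - ?u x s))) \<longlonglongrightarrow> integral {0..real N} (\<lambda>s. 0::real)"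
    proof (rule dominated_convergence(2))
      show "(\<lambda>s. norm (?u (X k) s - ?u x s)) integrable_on {0..real N}" for k
        by (intro integrable_continuous_real cn)
      show "(\<lambda>s. 2 * e :: real) integrable_on {0..real N}" by (rule integrable_const_ivl)
      show "norm (norm (?u (X k) s - ?u x s)) \<le> 2 * e" if "s \<in> {0..real N}" for k s
      proof -
        have "exp (- Re lam * s) \<le> 1" using that a by (simp add: mult_nonneg_nonneg)
        then have *: "norm (?u q s) \<le> 1 * e" for q
          unfolding norm_laplace_integrand by (intro mult_mono bd) auto
        have "norm (?u (X k) s - ?u x s) \<le> norm (?u (X k) s) + norm (?u x s)"
          by (rule norm_triangle_ineq4)
        with *[of "X k"] *[of x] show ?thesis by simp
      qed
      show "(\<lambda>k. norm (?u (X k) s - ?u x s)) \<longlonglongrightarrow> 0" for s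
      proof -
        have "(\<lambda>k. H s (X k)) \<longlonglongrightarrow> H s x"
          using continuous_on_tendsto_compose[OF Hx[of s] X] by simp
        then have "(\<lambda>k. ?u (X k) s) \<longlonglongrightarrow> ?u x s"
          by (intro scaleC.tendsto tendsto_intros)
        then show ?thesis by (intro tendsto_norm_zero) (simp add: LIM_zero_iff)
      qed
    qed
    then have lim0: "(\<lambda>k. integral {0..real N} (\<lambda>s. norm (?u (X k) s - ?u x s))) \<longlonglongrightarrow> 0"
      by simp
    have "norm (?w N (X k) - ?w N x) \<le> integral {0..real N} (\<lambda>s. norm (?u (X k) s - ?u x s))" for k
    proof -
      have "?w N (X k) - ?w N x = integral {0..real N} (\<lambda>s. ?u (X k) s - ?u x s)"
        unfolding laplace_upto_def by (rule Henstock_Kurzweil_Integration.integral_diff[symmetric]) (rule int)+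
      also have "norm \<dots> \<le> integral {0..real N} (\<lambda>s. norm (?u (X k) s - ?u x s))"
        by (rule integral_norm_bound_integral)
           (intro integrable_continuous_real continuous_intros cont order_refl)+
      finally show ?thesis .
    qed
    then have "(\<lambda>k. ?w N (X k) - ?w N x) \<longlonglongrightarrow> 0"
      by (intro Lim_null_comparison[OF _ lim0] always_eventually allI)
    then show "(\<lambda>k. ?w N (X k)) \<longlonglongrightarrow> ?w N x" by (simp add: LIM_zero_iff)
  qed
  then show "\<forall>\<^sub>F N in sequentially. continuous_on UNIV (?w N)" by simp
  show "uniform_limit UNIV ?w (\<lambda>x. laplace lam (\<lambda>s. H s x)) sequentially"
  proof (rule uniform_limitI)
    fix r :: real assume "0 < r"
    have "(\<lambda>N. e * exp (- Re lam * real N) / Re lam) \<longlonglongrightarrow> 0"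
      by (rule filterlim_compose[OF tendsto_laplace_tail[OF a] filterlim_real_sequentially])
    from order_tendstoD(2)[OF this \<open>0 < r\<close>]
    show "\<forall>\<^sub>F N in sequentially. \<forall>x\<in>UNIV. dist (?w N x) (laplace lam (\<lambda>s. H s x)) < r"
    proof eventually_elim
      case (elim N)
      show ?case
        using laplace_tail_bound[OF a Ht bd, of "real N"] elim
        by (auto simp: dist_norm norm_minus_commute intro: le_less_trans)
    qed
  qed
qed simp

section \<open>Stability along an abstract flow\<close>

lemma flow_stability_pos:
  fixes \<phi> :: "real \<Rightarrow> 'm::{first_countable_topology, t2_space} \<Rightarrow> 'm" and y :: "'m \<Rightarrow> 'b::complex_banach"
  assumes a: "0 < Re lam"
    and zero: "\<And>x. \<phi> 0 x = x" and add: "\<And>s t x. \<phi> (s + t) x = \<phi> s (\<phi> t x)"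
    and ct: "\<And>x. continuous_on UNIV (\<lambda>t. \<phi> t x)" and cx: "\<And>t. continuous_on UNIV (\<phi> t)"
    and y: "continuous_on UNIV y" and Y: "continuous_on UNIV Y" and f: "continuous_on UNIV f"
    and y': "\<And>x. ((\<lambda>t. y (\<phi> t x)) has_vector_derivative Y x) (at 0)"
    and bd: "\<And>x. norm (Y x - lam *\<^sub>C y x - f x) \<le> e"
  obtains z where "continuous_on UNIV z"
    "\<And>x. ((\<lambda>t. z (\<phi> t x)) has_vector_derivative lam *\<^sub>C z x + f x) (at 0)"
    "\<And>x. norm (y x - z x) \<le> e / Re lam"
proof -
  define g where "g x = Y x - lam *\<^sub>C y x - f x" for x
  have g: "continuous_on UNIV g"
    unfolding g_def by (intro continuous_intros scaleC.continuous_on y Y f)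
  define w where "w x = laplace lam (\<lambda>s. g (\<phi> s x))" for x
  have gt: "continuous_on UNIV (\<lambda>s. g (\<phi> s x))" for x
    by (rule continuous_on_compose2[OF g ct]) simp
  have gb: "norm (g (\<phi> s x)) \<le> e" for s x
    unfolding g_def by (rule bd)
  have w: "continuous_on UNIV w"
    unfolding w_def
    by (rule continuous_on_laplace[OF a gt _ gb]) (rule continuous_on_compose2[OF g cx], simp)
  \<comment> \<open>By the group law, moving the base point along the orbit by \<open>t\<close>
    translates the function \<open>s \<mapsto> g (\<phi> s x)\<close> by \<open>t\<close>, so the
    shift lemma differentiates \<open>w\<close> along the flow.\<close>
  have w': "((\<lambda>t. w (\<phi> t x)) has_vector_derivative lam *\<^sub>C w x - g x) (at 0)" for x
    using laplace_shift_has_vector_derivative[OF a gt[of x] gb] unfolding w_def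
    by (simp add: add zero)
  show thesis
  proof
    show "continuous_on UNIV (\<lambda>x. y x + w x)" by (intro continuous_intros y w)
    show "((\<lambda>t. y (\<phi> t x) + w (\<phi> t x)) has_vector_derivative lam *\<^sub>C (y x + w x) + f x) (at 0)" for x
      using has_vector_derivative_add[OF y' w', of x x]
      by (simp add: g_def scaleC_add_right algebra_simps)
    show "norm (y x - (y x + w x)) \<le> e / Re lam" for x
      using norm_laplace_le[OF a gt gb, of x] by (simp add: w_def)
  qed
qed

lemma flow_stability:
  fixes \<phi> :: "real \<Rightarrow> 'm::{first_countable_topology, t2_space} \<Rightarrow> 'm" and y :: "'m \<Rightarrow> 'b::complex_banach"
  assumes a: "Re lam \<noteq> 0"
    and zero: "\<And>x. \<phi> 0 x = x" and add: "\<And>s t x. \<phi> (s + t) x = \<phi> s (\<phi> t x)"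
    and ct: "\<And>x. continuous_on UNIV (\<lambda>t. \<phi> t x)" and cx: "\<And>t. continuous_on UNIV (\<phi> t)"
    and y: "continuous_on UNIV y" and Y: "continuous_on UNIV Y" and f: "continuous_on UNIV f"
    and y': "\<And>x. ((\<lambda>t. y (\<phi> t x)) has_vector_derivative Y x) (at 0)"
    and bd: "\<And>x. norm (Y x - lam *\<^sub>C y x - f x) \<le> e"
  obtains z where "continuous_on UNIV z"
    "\<And>x. ((\<lambda>t. z (\<phi> t x)) has_vector_derivative lam *\<^sub>C z x + f x) (at 0)"
    "\<And>x. norm (y x - z x) \<le> e / \<bar>Re lam\<bar>"
proof (cases "0 < Re lam")
  case True
  then show thesis
    using flow_stability_pos[OF True zero add ct cx y Y f y' bd] that by (metis abs_of_pos)
next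
  case False
  then have neg: "0 < Re (- lam)" using a by simp
  have reverse: "((\<lambda>t. k (\<phi> (- t) x)) has_vector_derivative - d) (at 0)"
    if "((\<lambda>t. k (\<phi> t x)) has_vector_derivative d) (at 0)" for k :: "'m \<Rightarrow> 'b" and x d
    using vector_diff_chain_at[of uminus "-1" 0 "\<lambda>t. k (\<phi> t x)" d] that
      has_vector_derivative_minus[OF has_vector_derivative_id]
    by (simp add: o_def)
  have reverse': "((\<lambda>t. k (\<phi> t x)) has_vector_derivative - d) (at 0)"
    if "((\<lambda>t. k (\<phi> (- t) x)) has_vector_derivative d) (at 0)" for k :: "'m \<Rightarrow> 'b" and x d
    using vector_diff_chain_at[of uminus "-1" 0 "\<lambda>t. k (\<phi> (-t) x)" d] that
      has_vector_derivative_minus[OF has_vector_derivative_id]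
    by (simp add: o_def)
  \<comment> \<open>Along the reversed flow \<open>y\<close> has derivative \<open>- Y\<close>, so
    the equation becomes the one with \<open>- lam\<close> and \<open>- f\<close>. The residual only
    changes sign, and \<open>Re (- lam)\<close> is the absolute value of
    \<open>Re lam\<close>.\<close>
  obtain z where z: "continuous_on UNIV z"
    "\<And>x. ((\<lambda>t. z (\<phi> (- t) x)) has_vector_derivative (- lam) *\<^sub>C z x + - f x) (at 0)"
    "\<And>x. norm (y x - z x) \<le> e / Re (- lam)"
  proof (rule flow_stability_pos[OF neg, of "\<lambda>t. \<phi> (- t)" y "\<lambda>x. - Y x" "\<lambda>x. - f x" e])
    show "\<phi> (- 0) x = x" for x by (simp add: zero)
    show "\<phi> (- (s + t)) x = \<phi> (- s) (\<phi> (- t) x)" for s t x by (simp flip: add)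
    show "continuous_on UNIV (\<lambda>t. \<phi> (- t) x)" for x
      by (intro continuous_on_compose2[OF ct] continuous_intros) simp
    show "((\<lambda>t. y (\<phi> (- t) x)) has_vector_derivative - Y x) (at 0)" for x
      by (rule reverse[OF y'])
    show "norm (- Y x - (- lam) *\<^sub>C y x - - f x) \<le> e" for x
      using bd[of x] norm_minus_cancel[of "Y x - lam *\<^sub>C y x - f x"]
      by (simp add: scaleC.minus_left algebra_simps)
  qed (use y Y f cx in \<open>auto intro: continuous_intros\<close>)
  show thesis
  proof (rule that[OF z(1)])
    show "((\<lambda>t. z (\<phi> t x)) has_vector_derivative lam *\<^sub>C z x + f x) (at 0)" for x
      using reverse'[OF z(2), of x] by (simp add: scaleC.minus_left add.commute)
    show "norm (y x - z x) \<le> e / \<bar>Re lam\<bar>" for x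
      using z(3)[of x] False by simp
  qed
qed

section \<open>Locally Lipschitz differential equations\<close>

text \<open>\<open>Ck_nat\<close> provides partial derivatives along the basis, not a total
  derivative, so the mean value inequality is applied to one coordinate at a time. A box is the
  convenient domain: all intermediate points remain in it, and by compactness one \<open>K\<close>
  bounds all partial derivatives there. Each coordinate contributes \<open>K\<close>, whence the
  constant \<open>DIM('e) * K\<close>.\<close>

lemma Ck_nat_one_locally_lipschitz:
  fixes F :: "'e::euclidean_space \<Rightarrow> 'f::real_normed_vector"
  assumes F: "Ck_nat 1 S F" and S: "open S" "x0 \<in> S"
  obtains r L where "0 < r" "0 \<le> L" "cball x0 r \<subseteq> S" "L-lipschitz_on (cball x0 r) F"
proof -
  obtain D :: "'e list \<Rightarrow> 'e \<Rightarrow> 'f" where D0: "D [] = F"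
    and Dd: "\<And>x v. x \<in> S \<Longrightarrow> v \<in> Basis \<Longrightarrow>
        ((\<lambda>t. F (x + t *\<^sub>R v)) has_vector_derivative D [v] x) (at 0)"
    and Dc: "\<And>v. v \<in> Basis \<Longrightarrow> continuous_on S (D [v])"
    using F unfolding Ck_nat_def by force
  obtain a b where ab: "cbox a b \<subseteq> S" "x0 \<in> box a b"
    using open_contains_cbox[OF S] by metis
  have "bounded (D [v] ` cbox a b)" if "v \<in> Basis" for v
    by (intro compact_imp_bounded compact_continuous_image continuous_on_subset[OF Dc[OF that] ab(1)]) simp
  then have "bounded (\<Union>v\<in>Basis. D [v] ` cbox a b)"
    by (intro bounded_UN) auto
  then obtain K where K: "0 < K" "\<And>v x. v \<in> Basis \<Longrightarrow> x \<in> cbox a b \<Longrightarrow> norm (D [v] x) \<le> K"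
    unfolding bounded_pos by blast
  have move: "norm (F (x + t *\<^sub>R v) - F x) \<le> K * \<bar>t\<bar>"
    if v: "v \<in> Basis" and x: "x \<in> cbox a b" and xt: "x + t *\<^sub>R v \<in> cbox a b" for x v t
  proof -
    let ?\<gamma> = "\<lambda>s. x + s *\<^sub>R v"
    have seg: "?\<gamma> s \<in> cbox a b" if "s \<in> closed_segment 0 t" for s
    proof -
      obtain c where c: "0 \<le> c" "c \<le> 1" "s = c * t"
        using \<open>s \<in> closed_segment 0 t\<close> by (auto simp: in_segment)
      have "(1 - c) *\<^sub>R x + c *\<^sub>R (x + t *\<^sub>R v) \<in> cbox a b"
        using convex_box(1)[of a b] x xt c unfolding convex_alt by blast
      then show ?thesis using c(3) by (simp add: algebra_simps)
    qed
    have der: "((\<lambda>s. F (?\<gamma> s)) has_derivative (\<lambda>h. h *\<^sub>R D [v] (?\<gamma> s))) (at s within closed_segment 0 t)"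
      if "s \<in> closed_segment 0 t" for s
    proof -
      have "?\<gamma> s \<in> S" using seg[OF that] ab by blast
      from Dd[OF this v]
      have d0: "((\<lambda>h. F (?\<gamma> s + h *\<^sub>R v)) has_vector_derivative D [v] (?\<gamma> s)) (at (s - s))" by simp
      have "((\<lambda>u. u - s) has_vector_derivative 1) (at s)"
        by (auto intro!: derivative_eq_intros)
      from vector_diff_chain_at[OF this d0]
      have "((\<lambda>u. F (?\<gamma> u)) has_vector_derivative D [v] (?\<gamma> s)) (at s)"
        by (simp add: o_def algebra_simps)
      then show ?thesis
        unfolding has_vector_derivative_def by (rule has_derivative_at_withinI)
    qed
    have "norm (F (?\<gamma> t) - F (?\<gamma> 0)) \<le> K * norm (t - 0)"
    proof (rule differentiable_bound[OF convex_closed_segment der])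
      show "onorm (\<lambda>h. h *\<^sub>R D [v] (?\<gamma> s)) \<le> K" if "s \<in> closed_segment 0 t" for s
        by (rule onorm_le) (use K(2)[OF v seg[OF that]] in \<open>simp add: mult.commute[of K] mult_left_mono\<close>)
    qed auto
    then show ?thesis by simp
  qed
  \<comment> \<open>Induction on the set \<open>B\<close> of coordinates in which \<open>x\<close>
    and \<open>y\<close> may differ. The intermediate point \<open>m\<close> is \<open>x\<close>
    with its \<open>v\<close>-coordinate replaced by that of \<open>y\<close>, and it is no farther
    from \<open>y\<close> than \<open>x\<close> is.\<close>
  have step: "norm (F y - F x) \<le> card B * K * norm (y - x)"
    if "finite B" "B \<subseteq> Basis" "x \<in> cbox a b" "y \<in> cbox a b"
      "\<forall>i\<in>Basis - B. x \<bullet> i = y \<bullet> i" for B x y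
    using that
  proof (induction B arbitrary: x rule: finite_induct)
    case empty
    then have "x = y" by (auto intro: euclidean_eqI)
    then show ?case by simp
  next
    case (insert v B)
    define m where "m = x + ((y - x) \<bullet> v) *\<^sub>R v"
    have v: "v \<in> Basis" using insert.prems by auto
    have m: "m \<bullet> i = (if i = v then y \<bullet> i else x \<bullet> i)" if "i \<in> Basis" for i
      using v that by (auto simp: m_def inner_add_left inner_diff_left inner_Basis)
    have mbox: "m \<in> cbox a b" using insert.prems(2,3) by (auto simp: mem_box m)
    have n1: "norm (y - m) \<le> norm (y - x)"
      by (rule norm_le_componentwise) (auto simp: m inner_diff_left)
    have "norm (F y - F m) \<le> card B * K * norm (y - m)"
      by (rule insert.IH) (use insert.prems mbox m in auto)
    also have "\<dots> \<le> card B * K * norm (y - x)"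
      using K(1) by (intro mult_left_mono n1) auto
    finally have 1: "norm (F y - F m) \<le> card B * K * norm (y - x)" .
    have "norm (F m - F x) \<le> K * \<bar>(y - x) \<bullet> v\<bar>"
      using move[OF v insert.prems(2)] mbox unfolding m_def by blast
    also have "\<dots> \<le> K * norm (y - x)"
      using K(1) v by (intro mult_left_mono Basis_le_norm) auto
    finally have 2: "norm (F m - F x) \<le> K * norm (y - x)" .
    have "norm (F y - F x) \<le> norm (F y - F m) + norm (F m - F x)"
      by (metis dist_norm dist_triangle)
    with 1 2 show ?case using insert.hyps by (simp add: algebra_simps)
  qed
  have lip: "(real DIM('e) * K)-lipschitz_on (cbox a b) F"
    using K(1) by (intro lipschitz_onI) (auto simp: dist_norm intro!: step)
  obtain r where r: "0 < r" "cball x0 r \<subseteq> box a b"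
    using ab(2) open_box[of a b] open_contains_cball by metis
  show thesis
  proof
    show "cball x0 r \<subseteq> S" using r ab box_subset_cbox by blast
    show "(real DIM('e) * K)-lipschitz_on (cball x0 r) F"
      using lip by (rule lipschitz_on_subset) (use r box_subset_cbox in blast)
  qed (use r K in auto)
qed

text \<open>Gronwall for an autonomous equation: \<open>exp (- 2 L t) (norm (u t - v t))\<^sup>2\<close> is nonincreasing.\<close>

lemma lipschitz_ode_distance_bound:
  fixes u v :: "real \<Rightarrow> 'e::real_inner"
  assumes lip: "L-lipschitz_on X F" and T: "0 \<le> T"
    and u: "\<And>t. 0 \<le> t \<Longrightarrow> t \<le> T \<Longrightarrow> u t \<in> X \<and> (u has_vector_derivative F (u t)) (at t)"
    and v: "\<And>t. 0 \<le> t \<Longrightarrow> t \<le> T \<Longrightarrow> v t \<in> X \<and> (v has_vector_derivative F (v t)) (at t)"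
  shows "norm (u T - v T) \<le> exp (L * T) * norm (u 0 - v 0)"
proof -
  \<comment> \<open>The squared norm is differentiable even where the two solutions meet, unlike the
    norm itself. Cauchy-Schwarz and the Lipschitz bound let its derivative grow at most at rate
    \<open>2 * L\<close>, which the exponential factor offsets.\<close>
  define h where "h t = exp (- 2 * L * t) * ((u t - v t) \<bullet> (u t - v t))" for t
  have "h T \<le> h 0"
  proof (rule DERIV_nonpos_imp_nonincreasing[OF T])
    fix t assume t: "0 \<le> t" "t \<le> T"
    let ?d = "u t - v t" and ?D = "F (u t) - F (v t)"
    have d: "((\<lambda>t. u t - v t) has_vector_derivative ?D) (at t)"
      using u[OF t] v[OF t] by (intro has_vector_derivative_diff) auto
    have "((\<lambda>t. (u t - v t) \<bullet> (u t - v t)) has_real_derivative 2 * (?d \<bullet> ?D)) (at t)"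
      using bounded_bilinear.has_vector_derivative[OF bounded_bilinear_inner d d]
      by (simp add: has_real_derivative_iff_has_vector_derivative inner_commute)
    moreover have "((\<lambda>t. exp (- 2 * L * t)) has_real_derivative - 2 * L * exp (- 2 * L * t)) (at t)"
      by (auto intro!: derivative_eq_intros)
    ultimately have "(h has_real_derivative
        - 2 * L * exp (- 2 * L * t) * (?d \<bullet> ?d) + 2 * (?d \<bullet> ?D) * exp (- 2 * L * t)) (at t)"
      unfolding h_def by (rule DERIV_mult[rotated])
    moreover have "- 2 * L * exp (- 2 * L * t) * (?d \<bullet> ?d) + 2 * (?d \<bullet> ?D) * exp (- 2 * L * t) \<le> 0"
    proof -
      have "?d \<bullet> ?D \<le> norm ?d * norm ?D" by (rule norm_cauchy_schwarz)
      also have "norm ?D \<le> L * norm ?d"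
        using lipschitz_onD[OF lip, of "u t" "v t"] u[OF t] v[OF t] by (simp add: dist_norm)
      finally have "?d \<bullet> ?D \<le> L * (?d \<bullet> ?d)"
        by (simp add: mult_left_mono mult.left_commute dot_square_norm power2_eq_square)
      then have "2 * exp (- 2 * L * t) * (?d \<bullet> ?D) \<le> 2 * exp (- 2 * L * t) * (L * (?d \<bullet> ?d))"
        by (intro mult_left_mono) auto
      then show ?thesis by (simp only: mult_ac)
    qed
    ultimately show "\<exists>y. (h has_real_derivative y) (at t) \<and> y \<le> 0"
      by blast
  qed
  then have "exp (- 2 * L * T) * (norm (u T - v T))\<^sup>2 \<le> (norm (u 0 - v 0))\<^sup>2"
    by (simp add: h_def dot_square_norm)
  then have "exp (2 * L * T) * (exp (- 2 * L * T) * (norm (u T - v T))\<^sup>2) \<le> exp (2 * L * T) * (norm (u 0 - v 0))\<^sup>2"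
    by (rule mult_left_mono) simp
  moreover have "exp (2 * L * T) * exp (- 2 * L * T) = 1"
    by (simp flip: exp_add)
  moreover have "exp (2 * L * T) = (exp (L * T))\<^sup>2"
    by (simp add: exp_double mult.assoc)
  ultimately have "(norm (u T - v T))\<^sup>2 \<le> (exp (L * T) * norm (u 0 - v 0))\<^sup>2"
    by (metis mult.assoc mult_1 power_mult_distrib)
  then show ?thesis by (rule power2_le_imp_le) simp
qed

section \<open>Integral curves\<close>

lemma integral_curveD:
  assumes "integral_curve A V J \<gamma>"
  shows "open J" "is_interval J" "continuous_on J \<gamma>"
    "\<And>t c. t \<in> J \<Longrightarrow> c \<in> A \<Longrightarrow> \<gamma> t \<in> fst c \<Longrightarrow>
      ((\<lambda>t. snd c (\<gamma> t)) has_vector_derivative V c (snd c (\<gamma> t))) (at t)"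
  using assms unfolding integral_curve_def o_def by blast+

lemma integral_curve_shift:
  assumes "integral_curve A V J \<gamma>"
  shows "integral_curve A V ((\<lambda>t. t - t0) ` J) (\<lambda>s. \<gamma> (s + t0))"
proof -
  have J: "(\<lambda>t. t - t0) ` J = {s. s + t0 \<in> J}"
    by (auto simp: image_iff) (metis add_diff_cancel_right')
  have "continuous_on {s. s + t0 \<in> J} (\<lambda>s. \<gamma> (s + t0))"
    by (rule continuous_on_compose2[OF integral_curveD(3)[OF assms]]) (auto intro: continuous_intros)
  moreover have "((\<lambda>s. snd c (\<gamma> (s + t0))) has_vector_derivative V c (snd c (\<gamma> (s + t0)))) (at s)"
    if "s + t0 \<in> J" "c \<in> A" "\<gamma> (s + t0) \<in> fst c" for s c
  proof -
    have "((\<lambda>s. s + t0) has_vector_derivative 1) (at s)"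
      by (auto intro!: derivative_eq_intros)
    moreover have "((\<lambda>t. snd c (\<gamma> t)) has_vector_derivative V c (snd c (\<gamma> (s + t0)))) (at (s + t0))"
      by (rule integral_curveD(4)[OF assms that])
    ultimately show ?thesis using vector_diff_chain_at[of "\<lambda>s. s + t0" 1 s] by (simp add: o_def)
  qed
  moreover have "open ((\<lambda>t. t - t0) ` J)" "is_interval ((\<lambda>t. t - t0) ` J)"
    using integral_curveD(1,2)[OF assms] by (simp_all add: open_translation_subtract)
  ultimately show ?thesis
    unfolding integral_curve_def J o_def by blast
qed

lemma integral_curve_reverse:
  assumes "integral_curve A V J \<gamma>"
  shows "integral_curve A (\<lambda>c x. - V c x) (uminus ` J) (\<lambda>s. \<gamma> (- s))"
proof -
  have "continuous_on (uminus ` J) (\<lambda>s. \<gamma> (- s))"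
    by (rule continuous_on_compose2[OF integral_curveD(3)[OF assms]]) (auto intro: continuous_intros)
  moreover have "((\<lambda>s. snd c (\<gamma> (- s))) has_vector_derivative - V c (snd c (\<gamma> (- s)))) (at s)"
    if s: "s \<in> uminus ` J" and c: "c \<in> A" "\<gamma> (- s) \<in> fst c" for s c
  proof -
    have "- s \<in> J" using s by auto
    have "(uminus has_vector_derivative - 1) (at s)"
      by (auto intro!: derivative_eq_intros)
    moreover from \<open>- s \<in> J\<close>
    have "((\<lambda>t. snd c (\<gamma> t)) has_vector_derivative V c (snd c (\<gamma> (- s)))) (at (- s))"
      using c by (rule integral_curveD(4)[OF assms])
    ultimately show ?thesis using vector_diff_chain_at[of uminus "-1" s] by (simp add: o_def)
  qed
  moreover have "open (uminus ` J)" "is_interval (uminus ` J)"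
    using integral_curveD(1,2)[OF assms] by (simp_all add: open_negations)
  ultimately show ?thesis
    unfolding integral_curve_def o_def by blast
qed

section \<open>Uniqueness and local continuity for locally Lipschitz fields\<close>

locale lipschitz_field =
  fixes A :: "('m::t2_space set \<times> ('m \<Rightarrow> 'e::euclidean_space)) set"
    and V :: "'m set \<times> ('m \<Rightarrow> 'e) \<Rightarrow> 'e \<Rightarrow> 'e"
  assumes cover: "(\<Union>c\<in>A. fst c) = UNIV"
    and chart: "c \<in> A \<Longrightarrow> is_chart c"
    and locally_lipschitz: "c \<in> A \<Longrightarrow> x \<in> snd c ` fst c \<Longrightarrow>
      \<exists>r>0. \<exists>L\<ge>0. cball x r \<subseteq> snd c ` fst c \<and> L-lipschitz_on (cball x r) (V c)"
begin

text \<open>Negating the field exchanges past and future. Since the locale is stable under this,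
  each forward-time result can be applied to the negated field and
  \<open>integral_curve_reverse\<close> to cover negative times.\<close>

lemma lipschitz_field_reverse: "lipschitz_field A (\<lambda>c x. - V c x)"
proof
  show "\<exists>r>0. \<exists>L\<ge>0. cball x r \<subseteq> snd c ` fst c \<and> L-lipschitz_on (cball x r) (\<lambda>x. - V c x)"
    if "c \<in> A" "x \<in> snd c ` fst c" for c x
    using locally_lipschitz[OF that] by (simp add: lipschitz_on_def dist_minus)
qed (use cover chart in auto)

lemma open_chart_ball:
  assumes "c \<in> A"
  shows "open {q \<in> fst c. snd c q \<in> ball x r}"
proof -
  obtain \<psi> where "homeomorphism (fst c) (snd c ` fst c) (snd c) \<psi>" and o: "open (fst c)"
    using chart[OF assms] unfolding is_chart_def by blast
  then have "continuous_on (fst c) (snd c)" by (simp add: homeomorphism_def)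
  from continuous_open_preimage[OF this o open_ball] show ?thesis
    by (simp add: vimage_def Int_def)
qed

text \<open>The set is the image of a compact ball under the inverse chart, hence compact, hence
  closed in the Hausdorff manifold and not just in the chart domain. A curve whose coordinates
  remain in the ball therefore cannot slip out of the chart in the limit.\<close>

lemma closed_chart_cball:
  assumes "c \<in> A" "cball x r \<subseteq> snd c ` fst c"
  shows "closed {q \<in> fst c. snd c q \<in> cball x r}"
proof -
  obtain \<psi> where h: "homeomorphism (fst c) (snd c ` fst c) (snd c) \<psi>"
    using chart[OF assms(1)] unfolding is_chart_def by blast
  have "{q \<in> fst c. snd c q \<in> cball x r} = \<psi> ` cball x r"
  proof (intro equalityI subsetI)
    fix q assume "q \<in> {q \<in> fst c. snd c q \<in> cball x r}"
    then show "q \<in> \<psi> ` cball x r"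
      using h by (intro image_eqI[of _ _ "snd c q"]) (auto simp: homeomorphism_def)
  next
    fix q assume "q \<in> \<psi> ` cball x r"
    then obtain w where w: "q = \<psi> w" "w \<in> cball x r" by blast
    then have "w \<in> snd c ` fst c" using assms(2) by blast
    with w h show "q \<in> {q \<in> fst c. snd c q \<in> cball x r}"
      by (auto simp: homeomorphism_def)
  qed
  moreover have "continuous_on (cball x r) \<psi>"
    using h by (intro continuous_on_subset[OF _ assms(2)]) (simp add: homeomorphism_def)
  ultimately show ?thesis
    by (simp add: compact_imp_closed compact_continuous_image)
qed

text \<open>For a short time both curves stay in one chart ball on which the field is Lipschitz.
  Their coordinates solve the same equation from the same point, so the distance bound is zero, and
  injectivity of the chart does the rest.\<close>

lemma curves_locally_agree_forward:
  assumes i: "integral_curve A V I \<gamma>" and j: "integral_curve A V I \<eta>"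
    and t0: "t0 \<in> I" "\<gamma> t0 = \<eta> t0"
  shows "\<exists>d>0. \<forall>t\<in>{t0..t0 + d}. \<gamma> t = \<eta> t"
proof -
  obtain c where c: "c \<in> A" "\<gamma> t0 \<in> fst c" using cover by blast
  then obtain r L where r: "0 < r" and lip: "L-lipschitz_on (cball (snd c (\<gamma> t0)) r) (V c)"
    using locally_lipschitz by (meson imageI)
  define N where "N = {q \<in> fst c. snd c q \<in> ball (snd c (\<gamma> t0)) r}"
  have oN: "open N" unfolding N_def by (rule open_chart_ball[OF c(1)])
  have oI: "open I" by (rule integral_curveD(1)[OF i])
  have "open (I \<inter> \<gamma> -` N)" "open (I \<inter> \<eta> -` N)"
    by (intro continuous_open_preimage oI oN integral_curveD(3)[OF i] integral_curveD(3)[OF j])+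
  then have "open ((I \<inter> \<gamma> -` N) \<inter> (I \<inter> \<eta> -` N))" by blast
  moreover have "t0 \<in> (I \<inter> \<gamma> -` N) \<inter> (I \<inter> \<eta> -` N)"
    using t0 c r by (auto simp: N_def)
  ultimately obtain d where d: "0 < d" "cball t0 d \<subseteq> (I \<inter> \<gamma> -` N) \<inter> (I \<inter> \<eta> -` N)"
    using open_contains_cball by metis
  have inN: "t \<in> I \<and> \<gamma> t \<in> N \<and> \<eta> t \<in> N" if "t0 \<le> t" "t \<le> t0 + d" for t
    using d(2) that by (auto simp: subset_iff dist_real_def)
  have "\<gamma> t = \<eta> t" if t: "t0 \<le> t" "t \<le> t0 + d" for t
  proof -
    have ode: "snd c (\<zeta> (s + t0)) \<in> cball (snd c (\<gamma> t0)) r \<and>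
        ((\<lambda>s. snd c (\<zeta> (s + t0))) has_vector_derivative V c (snd c (\<zeta> (s + t0)))) (at s)"
      if "integral_curve A V I \<zeta>" "0 \<le> s" "s \<le> t - t0" "\<zeta> (s + t0) \<in> N" for \<zeta> s
    proof -
      have "s \<in> (\<lambda>t. t - t0) ` I"
        using inN[of "s + t0"] that t by (auto simp: image_iff intro!: bexI[of _ "s + t0"])
      then show ?thesis
        using integral_curveD(4)[OF integral_curve_shift[OF that(1), of t0] _ c(1)] that(4)
        unfolding N_def by auto
    qed
    have "norm (snd c (\<gamma> (t - t0 + t0)) - snd c (\<eta> (t - t0 + t0)))
        \<le> exp (L * (t - t0)) * norm (snd c (\<gamma> (0 + t0)) - snd c (\<eta> (0 + t0)))"
    proof (rule lipschitz_ode_distance_bound[OF lip])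
      fix s assume s: "0 \<le> s" "s \<le> t - t0"
      then have N: "\<gamma> (s + t0) \<in> N" "\<eta> (s + t0) \<in> N" using inN[of "s + t0"] t by auto
      show "snd c (\<gamma> (s + t0)) \<in> cball (snd c (\<gamma> t0)) r \<and>
        ((\<lambda>s. snd c (\<gamma> (s + t0))) has_vector_derivative V c (snd c (\<gamma> (s + t0)))) (at s)"
        by (rule ode[OF i s N(1)])
      show "snd c (\<eta> (s + t0)) \<in> cball (snd c (\<gamma> t0)) r \<and>
        ((\<lambda>s. snd c (\<eta> (s + t0))) has_vector_derivative V c (snd c (\<eta> (s + t0)))) (at s)"
        by (rule ode[OF j s N(2)])
    qed (use t in simp)
    then have "snd c (\<gamma> t) = snd c (\<eta> t)" using t0(2) by simp
    moreover have "inj_on (snd c) (fst c)"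
      using chart[OF c(1)] unfolding is_chart_def homeomorphism_def by (metis inj_onI)
    ultimately show ?thesis
      using inN[OF t] by (auto simp: N_def dest: inj_onD)
  qed
  then show ?thesis using d(1) by auto
qed

lemma curves_locally_agree:
  assumes i: "integral_curve A V I \<gamma>" and j: "integral_curve A V I \<eta>"
    and t0: "t0 \<in> I" "\<gamma> t0 = \<eta> t0"
  shows "\<exists>d>0. \<forall>t\<in>{t0 - d..t0 + d}. \<gamma> t = \<eta> t"
proof -
  obtain d where d: "0 < d" "\<forall>t\<in>{t0..t0 + d}. \<gamma> t = \<eta> t"
    using curves_locally_agree_forward[OF assms] by blast
  have "\<exists>d>0. \<forall>t\<in>{- t0..- t0 + d}. \<gamma> (- t) = \<eta> (- t)"
    by (rule lipschitz_field.curves_locally_agree_forward[OF lipschitz_field_reverse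
          integral_curve_reverse[OF i] integral_curve_reverse[OF j]]) (use t0 in auto)
  then obtain d' where d': "0 < d'" "\<forall>t\<in>{- t0..- t0 + d'}. \<gamma> (- t) = \<eta> (- t)" by blast
  have "\<gamma> t = \<eta> t" if "t \<in> {t0 - min d d'..t0 + min d d'}" for t
  proof (cases "t0 \<le> t")
    case True
    then show ?thesis using d(2) that by auto
  next
    case False
    then have "- t \<in> {- t0..- t0 + d'}" using that by auto
    with d'(2) show ?thesis by fastforce
  qed
  then show ?thesis using d(1) d'(1) by (metis min_less_iff_conj)
qed

text \<open>The set of times of agreement is open in \<open>I\<close> by local agreement and closed
  in \<open>I\<close> because the diagonal of a Hausdorff space is closed; \<open>I\<close> is
  connected.\<close>

lemma integral_curve_unique:
  assumes i: "integral_curve A V I \<gamma>" and j: "integral_curve A V I \<eta>"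
    and t0: "t0 \<in> I" "\<gamma> t0 = \<eta> t0" and t: "t \<in> I"
  shows "\<gamma> t = \<eta> t"
proof -
  let ?E = "{t \<in> I. \<gamma> t = \<eta> t}"
  have I: "open I" "connected I" and cont: "continuous_on I \<gamma>" "continuous_on I \<eta>"
    using integral_curveD(1-3)[OF i] integral_curveD(3)[OF j] is_interval_connected by blast+
  have "open ?E"
    unfolding open_subopen[of ?E]
  proof
    fix s assume s: "s \<in> ?E"
    then obtain d where d: "0 < d" "\<forall>t\<in>{s - d..s + d}. \<gamma> t = \<eta> t"
      using curves_locally_agree[OF i j] by blast
    obtain e where e: "0 < e" "ball s e \<subseteq> I" using I(1) s openE by blast
    have "ball s (min d e) \<subseteq> ?E"
      using d(2) e(2) by (auto simp: dist_real_def subset_iff abs_real_def split: if_splits)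
    then show "\<exists>T. open T \<and> s \<in> T \<and> T \<subseteq> ?E"
      using d(1) e(1) by (intro exI[of _ "ball s (min d e)"]) auto
  qed
  then have "openin (top_of_set I) ?E" by (auto intro: open_subset)
  moreover have "closedin (top_of_set I) ?E"
  proof -
    have closed: "closed {p :: 'm \<times> 'm. fst p = snd p}"
      by (rule closed_Collect_eq) (intro continuous_intros)+
    have "continuous_on I (\<lambda>t. (\<gamma> t, \<eta> t))" by (intro continuous_intros cont)
    from continuous_closedin_preimage[OF this closed]
    show ?thesis by (simp add: vimage_def Int_def)
  qed
  ultimately have "?E = {} \<or> ?E = I"
    using I(2) unfolding connected_clopen by blast
  with t0 t show ?thesis by blast
qed

text \<open>A curve starting within \<open>r / 2\<close> of the centre with speed at most
  \<open>M\<close> moves at most \<open>M * d = r / 4\<close> up to time \<open>d\<close>, so it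
  stays within \<open>3 * r / 4\<close> and never leaves the chart. The time \<open>d\<close> is
  common to all starting points in \<open>W\<close>, so any two such curves can be compared by the
  Gronwall bound in the same coordinates.\<close>

lemma local_flow_forward:
  assumes \<phi>: "\<And>x. integral_curve A V UNIV (\<lambda>t. \<phi> t x)" "\<And>x. \<phi> 0 x = x"
  shows "\<exists>d>0. \<exists>W. open W \<and> p \<in> W \<and> (\<forall>s\<in>{0..d}. continuous_on W (\<phi> s))"
proof -
  obtain c where c: "c \<in> A" "p \<in> fst c" using cover by blast
  define P where "P = snd c p"
  obtain r L where r: "0 < r" "cball P r \<subseteq> snd c ` fst c" and L: "0 \<le> L"
    and lip: "L-lipschitz_on (cball P r) (V c)"
    using locally_lipschitz[OF c(1)] c(2) unfolding P_def by (meson imageI)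
  obtain \<psi> where h: "homeomorphism (fst c) (snd c ` fst c) (snd c) \<psi>"
    using chart[OF c(1)] unfolding is_chart_def by blast
  \<comment> \<open>The first two summands bound the field on the ball through its value at the
    centre and the Lipschitz constant; the 1 makes \<open>M\<close> positive, since \<open>d\<close>
    divides by it.\<close>
  define M where "M = norm (V c P) + L * r + 1"
  have M: "0 < M" "norm (V c x) \<le> M" if "x \<in> cball P r" for x
  proof -
    show "0 < M" unfolding M_def using L r by (simp add: add_nonneg_pos)
    have "norm (V c x - V c P) \<le> L * norm (x - P)"
      using lipschitz_onD[OF lip that, of P] r by (simp add: dist_norm)
    also have "\<dots> \<le> L * r"
      using that L by (intro mult_left_mono) (auto simp: dist_norm norm_minus_commute)
    finally show "norm (V c x) \<le> M"
      unfolding M_def using norm_triangle_sub[of "V c x" "V c P"] by linarith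
  qed
  have M0: "0 < M" using M(1)[of P] r by simp
  define d where "d = r / (4 * M)"
  define N where "N = {q \<in> fst c. snd c q \<in> ball P r}"
  define W where "W = {q \<in> fst c. snd c q \<in> ball P (r / 2)}"
  have oN: "open N" and oW: "open W" unfolding N_def W_def by (rule open_chart_ball[OF c(1)])+
  have d0: "0 < d" using r M0 by (simp add: d_def)
  have stay: "\<gamma> s \<in> N"
    if g: "integral_curve A V UNIV \<gamma>" and g0: "\<gamma> 0 \<in> W" and s: "0 \<le> s" "s \<le> d" for \<gamma> s
  proof (rule ccontr)
    assume "\<gamma> s \<notin> N"
    \<comment> \<open>Up to the first exit time from \<open>N\<close> the speed is at most \<open>M\<close>, so the curve
      cannot have left the smaller closed set \<open>K\<close>.\<close>
    define E where "E = {t. 0 \<le> t \<and> \<gamma> t \<notin> N}"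
    have cg: "continuous_on UNIV \<gamma>" by (rule integral_curveD(3)[OF g])
    have "closed (\<gamma> -` (- N))" using cg oN by (intro closed_vimage) auto
    then have "closed E" unfolding E_def using closed_Int[OF closed_atLeast[of 0], of "\<gamma> -` (- N)"]
      by (simp add: Int_def vimage_def)
    moreover have sE: "s \<in> E" using s \<open>\<gamma> s \<notin> N\<close> by (simp add: E_def)
    moreover have bE: "bdd_below E" by (auto simp: E_def bdd_below_def)
    ultimately have e: "Inf E \<in> E" using closed_contains_Inf by blast
    define e where "e = Inf E"
    have e_le: "e \<le> d" using cInf_lower[OF sE bE] s by (simp add: e_def)
    have eE: "0 \<le> e" "\<gamma> e \<notin> N" using e by (auto simp: E_def e_def)
    have "\<gamma> 0 \<in> N" using g0 r by (auto simp: W_def N_def)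
    then have e_pos: "0 < e" using eE by (cases "e = 0") auto
    have before: "\<gamma> t \<in> N" if "0 \<le> t" "t < e" for t
      using cInf_lower[OF _ bE, of t] that by (auto simp: E_def e_def)
    define K where "K = {q \<in> fst c. snd c q \<in> cball P (3 * r / 4)}"
    have "closed K" unfolding K_def
      by (rule closed_chart_cball[OF c(1)]) (use r in \<open>auto simp: subset_iff\<close>)
    have inK: "\<gamma> t \<in> K" if t: "0 \<le> t" "t < e" for t
    proof -
      have der: "((\<lambda>t. snd c (\<gamma> t)) has_derivative (\<lambda>h. h *\<^sub>R V c (snd c (\<gamma> u)))) (at u within {0..t})"
        if "u \<in> {0..t}" for u
        using integral_curveD(4)[OF g _ c(1), of u] before[of u] that t
        unfolding N_def has_vector_derivative_def by (auto intro: has_derivative_at_withinI)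
      have "norm (snd c (\<gamma> t) - snd c (\<gamma> 0)) \<le> M * norm (t - 0)"
      proof (rule differentiable_bound[OF convex_real_interval(5) der])
        show "onorm (\<lambda>h. h *\<^sub>R V c (snd c (\<gamma> u))) \<le> M" if "u \<in> {0..t}" for u
        proof (rule onorm_le)
          have "snd c (\<gamma> u) \<in> cball P r" using before[of u] that t by (auto simp: N_def)
          from M(2)[OF this] show "norm (h *\<^sub>R V c (snd c (\<gamma> u))) \<le> M * norm h" for h :: real
            by (simp add: mult.commute[of M] mult_left_mono)
        qed
      qed (use t in auto)
      also have "\<dots> \<le> M * d" using t e_le M0 by (intro mult_left_mono) auto
      also have "\<dots> = r / 4" using M0 by (simp add: d_def)
      finally have "dist (snd c (\<gamma> 0)) (snd c (\<gamma> t)) \<le> r / 4"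
        by (simp add: dist_norm norm_minus_commute)
      moreover have "dist P (snd c (\<gamma> 0)) < r / 2" using g0 by (simp add: W_def)
      ultimately have "dist P (snd c (\<gamma> t)) \<le> 3 * r / 4"
        using dist_triangle[of P "snd c (\<gamma> t)" "snd c (\<gamma> 0)"] by linarith
      then show ?thesis using before[OF t] by (simp add: K_def N_def)
    qed
    \<comment> \<open>The curve lies in \<open>K\<close> just before \<open>e\<close> and
      \<open>K\<close> is closed. As \<open>3 * r / 4 < r\<close>, \<open>K\<close> is contained in
      \<open>N\<close>, so \<open>e\<close> is not an exit time after all.\<close>
    have "\<gamma> e \<in> K"
    proof (rule Lim_in_closed_set[OF \<open>closed K\<close>])
      show "(\<gamma> \<longlongrightarrow> \<gamma> e) (at_left e)"
        using cg by (simp add: continuous_on_def filterlim_at_split)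
      show "\<forall>\<^sub>F t in at_left e. \<gamma> t \<in> K"
        using eventually_at_left_real[OF e_pos] by eventually_elim (auto intro: inK)
    qed simp
    then have "\<gamma> e \<in> N" using r by (auto simp: K_def N_def)
    with eE show False by blast
  qed
  have "continuous_on W (\<phi> s)"
    if s: "s \<in> {0..d}" for s
  proof -
    have stays: "\<phi> u x \<in> N" if "x \<in> W" "u \<in> {0..d}" for x u
      using stay[OF \<phi>(1)] \<phi>(2) that by auto
    have ode: "snd c (\<phi> u x) \<in> cball P r \<and>
        ((\<lambda>u. snd c (\<phi> u x)) has_vector_derivative V c (snd c (\<phi> u x))) (at u)"
      if "x \<in> W" "0 \<le> u" "u \<le> s" for x u
      using integral_curveD(4)[OF \<phi>(1)[of x] _ c(1), of u] stays[of x u] s that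
      unfolding N_def by auto
    have est: "dist (snd c (\<phi> s x)) (snd c (\<phi> s q)) \<le> exp (L * s) * dist (snd c x) (snd c q)"
      if "x \<in> W" "q \<in> W" for x q
      using lipschitz_ode_distance_bound[OF lip _ ode[OF that(1)] ode[OF that(2)], of s] s \<phi>(2)
      by (simp add: dist_norm)
    \<comment> \<open>In coordinates the time-\<open>s\<close> map is Lipschitz with constant
      \<open>exp (L * s)\<close>; composing with the chart and its inverse carries continuity back
      to \<open>W\<close>.\<close>
    have "continuous_on (snd c ` W) (\<lambda>P. snd c (\<phi> s (\<psi> P)))"
    proof (rule lipschitz_on_continuous_on, rule lipschitz_onI)
      fix P Q assume "P \<in> snd c ` W" "Q \<in> snd c ` W"
      moreover have "\<psi> (snd c x) = x" if "x \<in> W" for x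
        using h that by (auto simp: homeomorphism_def W_def)
      ultimately show "dist (snd c (\<phi> s (\<psi> P))) (snd c (\<phi> s (\<psi> Q))) \<le> exp (L * s) * dist P Q"
        using est by auto
    qed simp
    moreover have "continuous_on W (snd c)"
      using h continuous_on_subset unfolding homeomorphism_def W_def by fastforce
    ultimately have inner: "continuous_on W (\<lambda>x. snd c (\<phi> s (\<psi> (snd c x))))"
      by (rule continuous_on_compose2) simp
    have "continuous_on (snd c ` fst c) \<psi>" using h by (simp add: homeomorphism_def)
    then have "continuous_on W (\<lambda>x. \<psi> (snd c (\<phi> s (\<psi> (snd c x)))))"
      using inner
    proof (rule continuous_on_compose2)
      show "(\<lambda>x. snd c (\<phi> s (\<psi> (snd c x)))) ` W \<subseteq> snd c ` fst c"
        using stays s h by (auto simp: N_def W_def homeomorphism_def)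
    qed
    then show ?thesis
    proof (rule continuous_on_eq)
      show "\<psi> (snd c (\<phi> s (\<psi> (snd c x)))) = \<phi> s x" if "x \<in> W" for x
        using stays[OF that s] h that by (auto simp: N_def W_def homeomorphism_def)
    qed
  qed
  moreover have "p \<in> W" using c r by (simp add: W_def P_def)
  ultimately show ?thesis using d0 oW by blast
qed

lemma local_flow:
  assumes \<phi>: "\<And>x. integral_curve A V UNIV (\<lambda>t. \<phi> t x)" "\<And>x. \<phi> 0 x = x"
  shows "\<exists>d>0. \<exists>W. open W \<and> p \<in> W \<and> (\<forall>s\<in>{-d..d}. continuous_on W (\<phi> s))"
proof -
  obtain d W where d: "0 < d" "open W" "p \<in> W" "\<forall>s\<in>{0..d}. continuous_on W (\<phi> s)"
    using local_flow_forward[OF \<phi>] by blast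
  have "\<exists>d>0. \<exists>W. open W \<and> p \<in> W \<and> (\<forall>s\<in>{0..d}. continuous_on W (\<phi> (- s)))"
  proof (rule lipschitz_field.local_flow_forward[OF lipschitz_field_reverse])
    show "integral_curve A (\<lambda>c x. - V c x) UNIV (\<lambda>t. \<phi> (- t) x)" for x
      using integral_curve_reverse[OF \<phi>(1)] by simp
  qed (simp add: \<phi>(2))
  then obtain d' W' where d': "0 < d'" "open W'" "p \<in> W'" "\<forall>s\<in>{0..d'}. continuous_on W' (\<phi> (- s))"
    by blast
  have "continuous_on (W \<inter> W') (\<phi> s)" if "s \<in> {- min d d'..min d d'}" for s
  proof (cases "0 \<le> s")
    case True
    then show ?thesis using d(4) that by (auto intro: continuous_on_subset)
  next
    case False
    then have "- s \<in> {0..d'}" using that by auto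
    with d'(4) show ?thesis by (metis Int_lower2 add.inverse_inverse continuous_on_subset)
  qed
  then show ?thesis
    using d d' by (intro exI[of _ "min d d'"] conjI exI[of _ "W \<inter> W'"]) auto
qed

end

section \<open>From short-time to all-time continuity of a flow\<close>

lemma flow_continuous_if_locally_continuous:
  fixes \<phi> :: "real \<Rightarrow> 'm::t2_space \<Rightarrow> 'm"
  assumes zero: "\<And>x. \<phi> 0 x = x" and add: "\<And>s t x. \<phi> (s + t) x = \<phi> s (\<phi> t x)"
    and ct: "\<And>x. continuous_on UNIV (\<lambda>t. \<phi> t x)"
    and loc: "\<And>p. \<exists>d>0. \<exists>W. open W \<and> p \<in> W \<and> (\<forall>s\<in>{-d..d}. continuous_on W (\<phi> s))"
  shows "continuous_on UNIV (\<phi> t)"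
proof -
  have "isCont (\<phi> t) x" for x
  proof -
    \<comment> \<open>The set of times at which the flow is continuous at \<open>x\<close> is open and closed.\<close>
    define Z where "Z = {t. isCont (\<phi> t) x}"
    \<comment> \<open>For times within \<open>d / 2\<close> of \<open>t0\<close>,
      \<open>\<phi> t2\<close> is \<open>\<phi> t1\<close> followed by
      \<open>\<phi> (t2 - t1)\<close>, and the latter is continuous on \<open>W\<close>, which
      contains \<open>\<phi> t1 x\<close>. The claim is symmetric in \<open>t1\<close> and
      \<open>t2\<close>, so it yields openness of both \<open>Z\<close> and its complement.\<close>
    have nbhd: "\<exists>e>0. \<forall>t1\<in>ball t0 e. \<forall>t2\<in>ball t0 e. t1 \<in> Z \<longrightarrow> t2 \<in> Z" for t0
    proof -
      obtain d W where d: "0 < d" "open W" "\<phi> t0 x \<in> W" "\<forall>s\<in>{-d..d}. continuous_on W (\<phi> s)"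
        using loc by blast
      have "open ((\<lambda>t. \<phi> t x) -` W)" using ct d(2) by (rule open_vimage[rotated])
      then obtain e where e: "0 < e" "ball t0 e \<subseteq> (\<lambda>t. \<phi> t x) -` W"
        using d(3) openE by blast
      have "t2 \<in> Z" if t: "t1 \<in> ball t0 (min e (d/2))" "t2 \<in> ball t0 (min e (d/2))" "t1 \<in> Z" for t1 t2
      proof -
        have "\<bar>t0 - t1\<bar> < d / 2" "\<bar>t0 - t2\<bar> < d / 2" using t by (auto simp: dist_real_def)
        then have "t2 - t1 \<in> {-d..d}" unfolding atLeastAtMost_iff by linarith
        moreover have "\<phi> t1 x \<in> W" using t e by auto
        ultimately have "isCont (\<phi> (t2 - t1)) (\<phi> t1 x)"
          using d continuous_on_eq_continuous_at by blast
        with t(3) have "isCont (\<lambda>x. \<phi> (t2 - t1) (\<phi> t1 x)) x"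
          unfolding Z_def by (auto intro: isCont_o2)
        then show ?thesis by (simp add: Z_def flip: add)
      qed
      moreover have "0 < min e (d/2)" using d(1) e(1) by simp
      ultimately show ?thesis by blast
    qed
    have "open Z"
      unfolding open_contains_ball
    proof
      fix t0 assume "t0 \<in> Z"
      moreover obtain e where "0 < e" "\<forall>t1\<in>ball t0 e. \<forall>t2\<in>ball t0 e. t1 \<in> Z \<longrightarrow> t2 \<in> Z"
        using nbhd by blast
      ultimately show "\<exists>e>0. ball t0 e \<subseteq> Z" by (intro exI[of _ e]) auto
    qed
    moreover have "open (- Z)"
      unfolding open_contains_ball
    proof
      fix t0 assume "t0 \<in> - Z"
      moreover obtain e where "0 < e" "\<forall>t1\<in>ball t0 e. \<forall>t2\<in>ball t0 e. t1 \<in> Z \<longrightarrow> t2 \<in> Z"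
        using nbhd by blast
      ultimately show "\<exists>e>0. ball t0 e \<subseteq> - Z" by (intro exI[of _ e]) auto
    qed
    then have "closed Z" by (simp add: closed_def)
    moreover have "\<phi> 0 = (\<lambda>x. x)" by (rule ext) (rule zero)
    then have "0 \<in> Z" by (simp add: Z_def)
    ultimately have "Z = UNIV" using clopen by blast
    then show ?thesis by (auto simp: Z_def)
  qed
  then show ?thesis by (simp add: continuous_on_eq_continuous_at)
qed

lemma lipschitz_fieldI:
  fixes A :: "('m::t2_space set \<times> ('m \<Rightarrow> 'e::euclidean_space)) set"
  assumes "1 \<le> p" "Ck_atlas k A" "Ck_vector_field p A V"
  shows "lipschitz_field A V"
proof
  show "(\<Union>c\<in>A. fst c) = UNIV" and chart: "\<And>c. c \<in> A \<Longrightarrow> is_chart c"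
    using assms(2) by (auto simp: Ck_atlas_def)
  show "\<exists>r>0. \<exists>L\<ge>0. cball x r \<subseteq> snd c ` fst c \<and> L-lipschitz_on (cball x r) (V c)"
    if c: "c \<in> A" "x \<in> snd c ` fst c" for c x
  proof -
    have "enat 1 \<le> p" using assms(1) by (simp add: one_enat_def)
    then have "Ck_nat 1 (snd c ` fst c) (V c)"
      using assms(3) c unfolding Ck_vector_field_def Ck_on_def by blast
    moreover have "open (snd c ` fst c)" using chart[OF c(1)] by (simp add: is_chart_def)
    ultimately show ?thesis
      using Ck_nat_one_locally_lipschitz[OF _ _ c(2)] by metis
  qed
qed

section \<open>The global flow and differentiation along it\<close>

locale complete_lipschitz_field = lipschitz_field +
  assumes complete: "complete_vf A V"
begin

text \<open>The choice term is literally the one in \<open>Vderiv\<close>, which makes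
  \<open>Vderiv_eq\<close> a mere unfolding.\<close>

definition flow :: "real \<Rightarrow> 'a \<Rightarrow> 'a" where
  "flow t x = (SOME \<gamma>. integral_curve A V UNIV \<gamma> \<and> \<gamma> 0 = x) t"

lemma flow_curve: "integral_curve A V UNIV (\<lambda>t. flow t x)"
  and flow_zero: "flow 0 x = x"
proof -
  have "\<exists>\<gamma>. integral_curve A V UNIV \<gamma> \<and> \<gamma> 0 = x"
    using complete unfolding complete_vf_def by blast
  from someI_ex[OF this] show "integral_curve A V UNIV (\<lambda>t. flow t x)" "flow 0 x = x"
    by (auto simp: flow_def)
qed

text \<open>Uniqueness identifies every integral curve, on whatever interval it lives, with a piece
  of a flow orbit. Applied to an orbit itself this is the group law; applied to an arbitrary curve
  it gives \<open>diff_alongI\<close>.\<close>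

lemma integral_curve_eq_flow:
  assumes g: "integral_curve A V J \<gamma>" and t: "t0 \<in> J" "t \<in> J"
  shows "\<gamma> t = flow (t - t0) (\<gamma> t0)"
proof -
  have "integral_curve A V UNIV (\<lambda>t. flow (t - t0) (\<gamma> t0))"
    using integral_curve_shift[OF flow_curve, of "- t0"] by (simp add: surj_plus_right)
  then have "integral_curve A V J (\<lambda>t. flow (t - t0) (\<gamma> t0))"
    using g unfolding integral_curve_def by (auto intro: continuous_on_subset)
  from integral_curve_unique[OF g this t(1) _ t(2)] show ?thesis by (simp add: flow_zero)
qed

lemma flow_add: "flow (s + t) x = flow s (flow t x)"
  using integral_curve_eq_flow[OF flow_curve, of t "s + t" x] by simp

lemma continuous_on_flow_time: "continuous_on UNIV (\<lambda>t. flow t x)"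
  by (rule integral_curveD(3)[OF flow_curve])

lemma continuous_on_flow: "continuous_on UNIV (flow t)"
  by (rule flow_continuous_if_locally_continuous[OF flow_zero flow_add continuous_on_flow_time
        local_flow[OF flow_curve flow_zero]])

lemma Vderiv_eq: "Vderiv A V y x = vector_derivative (\<lambda>t. y (flow t x)) (at 0)"
  by (simp add: Vderiv_def flow_def o_def)

lemma diff_along_has_vector_derivative:
  assumes "diff_along A V y"
  shows "((\<lambda>t. y (flow t x)) has_vector_derivative Vderiv A V y x) (at 0)"
proof -
  have "(y \<circ> (\<lambda>t. flow t x)) differentiable (at 0)"
    using assms[unfolded diff_along_def, THEN spec[of _ UNIV], THEN spec[of _ "\<lambda>t. flow t x"]]
      flow_curve[of x] by simp
  then show ?thesis
    unfolding Vderiv_eq o_def by (simp only: vector_derivative_works)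
qed

text \<open>Derivatives at time 0 suffice because near \<open>t0\<close> a curve is the orbit of
  \<open>\<gamma> t0\<close> with time shifted by \<open>t0\<close>, and the hypothesis is available
  at every base point.\<close>

lemma diff_alongI:
  assumes "\<And>x. ((\<lambda>t. y (flow t x)) has_vector_derivative d x) (at 0)"
  shows "diff_along A V y"
  unfolding diff_along_def
proof (intro allI impI ballI)
  fix J \<gamma> t0 assume g: "integral_curve A V J \<gamma>" and t0: "t0 \<in> J"
  have "((\<lambda>t. t - t0) has_vector_derivative 1) (at t0)"
    by (auto intro!: derivative_eq_intros)
  then have "((\<lambda>t. y (flow (t - t0) (\<gamma> t0))) has_vector_derivative d (\<gamma> t0)) (at t0)"
    using vector_diff_chain_at[of "\<lambda>t. t - t0" 1 t0 "\<lambda>t. y (flow t (\<gamma> t0))" "d (\<gamma> t0)"]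
      assms[of "\<gamma> t0"]
    by (simp add: o_def)
  then have "((y \<circ> \<gamma>) has_vector_derivative d (\<gamma> t0)) (at t0)"
  proof (rule has_vector_derivative_transform_within_open)
    show "y (flow (t - t0) (\<gamma> t0)) = (y \<circ> \<gamma>) t" if "t \<in> J" for t
      unfolding o_def integral_curve_eq_flow[OF g t0 that] ..
  qed (use t0 integral_curveD(1)[OF g] in auto)
  then show "(y \<circ> \<gamma>) differentiable (at t0)"
    by (rule differentiableI_vector)
qed

end

theorem theorem2p2:
  fixes A :: "('m::{t2_space, second_countable_topology} set \<times> ('m \<Rightarrow> 'e::euclidean_space)) set"
    and V :: "'m set \<times> ('m \<Rightarrow> 'e) \<Rightarrow> 'e \<Rightarrow> 'e"
    and p :: enat
    and f :: "'m \<Rightarrow> 'b::complex_banach"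
    and lam :: complex
  assumes "1 \<le> p"
    and "Ck_atlas (p + 1) A"
    and "Ck_vector_field p A V"
    and "complete_vf A V"
    and "Re lam \<noteq> 0"
    and "continuous_on UNIV f"
  shows "\<forall>\<epsilon>::real. \<forall>y. \<epsilon> \<ge> 0 \<and> C1V A V y \<and>
            (\<forall>x. norm (Vderiv A V y x - lam *\<^sub>C y x - f x) \<le> \<epsilon>) \<longrightarrow>
          (\<exists>z. C1V A V z \<and> (\<forall>x. Vderiv A V z x = lam *\<^sub>C z x + f x) \<and>
               (\<forall>x. norm (y x - z x) \<le> \<epsilon> / \<bar>Re lam\<bar>))"
proof (intro allI impI, elim conjE)
  fix \<epsilon> :: real and y
  assume y: "C1V A V y" and bd: "\<forall>x. norm (Vderiv A V y x - lam *\<^sub>C y x - f x) \<le> \<epsilon>"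
  interpret complete_lipschitz_field A V
    using lipschitz_fieldI[OF assms(1-3)] assms(4)
    by (simp add: complete_lipschitz_field_def complete_lipschitz_field_axioms_def)
  obtain z where z: "continuous_on UNIV z"
    "\<And>x. ((\<lambda>t. z (flow t x)) has_vector_derivative lam *\<^sub>C z x + f x) (at 0)"
    "\<And>x. norm (y x - z x) \<le> \<epsilon> / \<bar>Re lam\<bar>"
  proof (rule flow_stability[OF assms(5), of flow y "Vderiv A V y" f \<epsilon>])
    show "((\<lambda>t. y (flow t x)) has_vector_derivative Vderiv A V y x) (at 0)" for x
      using y by (intro diff_along_has_vector_derivative) (simp add: C1V_def)
  qed (use y bd assms(6) flow_zero flow_add continuous_on_flow_time continuous_on_flow in
        \<open>auto simp: C1V_def\<close>)
  have Vz: "Vderiv A V z x = lam *\<^sub>C z x + f x" for x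
    unfolding Vderiv_eq using z(2) by (rule vector_derivative_at)
  \<comment> \<open>Continuity of the derivative of \<open>z\<close> comes from the equation itself,
    whose right-hand side is continuous.\<close>
  have "continuous_on UNIV (\<lambda>x. lam *\<^sub>C z x + f x)"
    by (intro continuous_intros scaleC.continuous_on z(1) assms(6))
  then have "C1V A V z"
    using z(1) diff_alongI[OF z(2)] by (simp add: C1V_def Vz[abs_def])
  with Vz z(3) show "\<exists>z. C1V A V z \<and> (\<forall>x. Vderiv A V z x = lam *\<^sub>C z x + f x) \<and>
               (\<forall>x. norm (y x - z x) \<le> \<epsilon> / \<bar>Re lam\<bar>)"
    by blast
qed

end
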